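(* Let $G=(\mathcal{V},\mathcal{A})$ be a finite directed graph with distinct source $s\in\mathcal{V}$ and sink $t\in\mathcal{V}$. Let each arc $a\in\mathcal{A}$ have an original capacity $u_a\ge 0$ and a cost $c_a\ge 0$ per unit of added capacity, and let $\phi\ge 0$ be the cost per unit of unsatisfied demand. Let $\mu>0$ and $\sigma\ge 0$. For $\tilde d\ge 0$ define $$F(\tilde d)=\min_{(x,f)\in X(\tilde d)} \sum_{a\in\mathcal{A}} c_a x_a+\phi\, N(\tilde d),$$ where $X(\tilde d)$ is the set of capacity expansions and flows $(x,f)$ of flow value $\tilde d$, and $N(\tilde d)$ is the worst-case expected unsatisfied demand over demand distributions with mean $\mu$ and variance $\sigma^2$ (both defined precisely in the context). Then the function $F$ is convex in $\tilde d$ on $[0,\infty)$.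
   Context: For a node $v$, $\delta^+(v)$ and $\delta^-(v)$ denote the sets of outgoing and incoming arcs at $v$. For $\tilde d\ge 0$, $X(\tilde d)$ is the set of pairs $(x,f)\in\mathbb{R}^{\mathcal{A}}\times\mathbb{R}^{\mathcal{A}}$ such that - $\sum_{a\in\delta^-(v)} f_a-\sum_{a\in\delta^+(v)} f_a=0$ for all $v\in\mathcal{V}\setminus\{s,t\}$, - $\sum_{a\in\delta^-(t)} f_a-\sum_{a\in\delta^+(t)} f_a=\tilde d$, - $\sum_{a\in\delta^-(s)} f_a-\sum_{a\in\delta^+(s)} f_a=-\tilde d$, - $f_a\le u_a+x_a$, $f_a\ge 0$ and $x_a\ge 0$ for all $a\in\mathcal{A}$. The minimum over an empty set is $+\infty$, so $F$ takes values in $\mathbb{R}\cup\{+\infty\}$, and convexity is understood in the extended-valued sense. Let $\mathcal{P}$ be the set of all Borel probability distributions $\mathbb{P}$ of a nonnegative real random variable $d$ with $\mathbb{E}_{\mathbb{P}}[d]=\mu$ and $\mathbb{E}_{\mathbb{P}}[(d-\mu)^2]=\sigma^2$. Then $$N(\tilde d)=\max_{\mathbb{P}\in\mathcal{P}} \mathbb{E}_{\mathbb{P}}\big[\max\{d-\tilde d,0\}\big],$$ where the maximum may be read as a supremum. *)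

theory Defs
  imports "HOL-Probability.Probability" "Graph_Theory.Digraph"
begin

(* Elements of R^A are represented as functions on the arc type that are extensional
   (undefined) off the arc set. *)
definition expansion_flows ::
  "('v, 'a) pre_digraph \<Rightarrow> 'v \<Rightarrow> 'v \<Rightarrow> ('a \<Rightarrow> real) \<Rightarrow> real \<Rightarrow> (('a \<Rightarrow> real) \<times> ('a \<Rightarrow> real)) set"
where
  "expansion_flows G s t u dt = {(x, f).
     x \<in> extensional (arcs G) \<and> f \<in> extensional (arcs G) \<and>
     (\<forall>v \<in> verts G - {s, t}. (\<Sum>a\<in>in_arcs G v. f a) - (\<Sum>a\<in>out_arcs G v. f a) = 0) \<and>
     (\<Sum>a\<in>in_arcs G t. f a) - (\<Sum>a\<in>out_arcs G t. f a) = dt \<and>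
     (\<Sum>a\<in>in_arcs G s. f a) - (\<Sum>a\<in>out_arcs G s. f a) = - dt \<and>
     (\<forall>a \<in> arcs G. f a \<le> u a + x a \<and> 0 \<le> f a \<and> 0 \<le> x a)}"

(* The integrability conditions are needed because the Bochner integral of a
   non-integrable function is 0. *)
definition demand_distributions :: "real \<Rightarrow> real \<Rightarrow> real measure set" where
  "demand_distributions \<mu> \<sigma> = {P. real_distribution P \<and> (AE d in P. 0 \<le> d) \<and>
     integrable P (\<lambda>d. d) \<and> (\<integral>d. d \<partial>P) = \<mu> \<and>
     integrable P (\<lambda>d. (d - \<mu>)\<^sup>2) \<and> (\<integral>d. (d - \<mu>)\<^sup>2 \<partial>P) = \<sigma>\<^sup>2}"

definition worst_unsatisfied_demand :: "real \<Rightarrow> real \<Rightarrow> real \<Rightarrow> ereal" where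
  "worst_unsatisfied_demand \<mu> \<sigma> dt =
     (SUP P \<in> demand_distributions \<mu> \<sigma>. ereal (\<integral>d. max (d - dt) 0 \<partial>P))"

(* The infimum over the empty set is \<infinity> in ereal, as required when no feasible pair exists. *)
definition expansion_objective ::
  "('v, 'a) pre_digraph \<Rightarrow> 'v \<Rightarrow> 'v \<Rightarrow> ('a \<Rightarrow> real) \<Rightarrow> ('a \<Rightarrow> real) \<Rightarrow> real \<Rightarrow> real \<Rightarrow> real
     \<Rightarrow> real \<Rightarrow> ereal"
where
  "expansion_objective G s t u c \<phi> \<mu> \<sigma> dt =
     (INF (x, f) \<in> expansion_flows G s t u dt. ereal (\<Sum>a\<in>arcs G. c a * x a))
       + ereal \<phi> * worst_unsatisfied_demand \<mu> \<sigma> dt"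

(* Excluding -\<infinity> makes F a function into the reals extended by +\<infinity>, so no sum below is of the form
   \<infinity> - \<infinity>; the endpoint cases use the convention 0 * \<infinity> = 0 of ereal and are harmless. *)
definition ereal_convex_on :: "'a::real_vector set \<Rightarrow> ('a \<Rightarrow> ereal) \<Rightarrow> bool" where
  "ereal_convex_on S F \<longleftrightarrow> convex S \<and> (\<forall>x\<in>S. F x \<noteq> -\<infinity>) \<and>
     (\<forall>x\<in>S. \<forall>y\<in>S. \<forall>a\<ge>0. \<forall>b\<ge>0. a + b = 1 \<longrightarrow>
        F (a *\<^sub>R x + b *\<^sub>R y) \<le> ereal a * F x + ereal b * F y)"

end

theory Submission
  imports Defs
begin

text \<open>The cost term is the partial minimum over \<open>(x, f)\<close> of a linear function on a jointly convex set,
  hence convex in the flow value, while the worst-case demand is a supremum of the convex functions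
  \<open>\<lambda>d'. E (max (d - d') 0)\<close>. The value \<open>-\<infinity>\<close> is excluded because the supremum is not over
  the empty set: there is an admissible distribution supported on \<open>0\<close> and \<open>(\<mu>\<^sup>2 + \<sigma>\<^sup>2) / \<mu>\<close>.\<close>

text \<open>Nonnegativity excludes -\<infinity> and confines the work to positive weights and finite
  values. A zero weight removes its term, as 0 * \<infinity> = 0 in \<open>ereal\<close>, and with
  positive weights an infinite value makes the right-hand side \<infinity>.\<close>

lemma ereal_convex_onI:
  assumes "convex S" and "\<And>x. x \<in> S \<Longrightarrow> 0 \<le> F x"
    and step: "\<And>x y a b. \<lbrakk>x \<in> S; y \<in> S; 0 < a; 0 < b; a + b = 1; F x \<noteq> \<infinity>; F y \<noteq> \<infinity>\<rbrakk> \<Longrightarrow>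
      F (a *\<^sub>R x + b *\<^sub>R y) \<le> ereal a * F x + ereal b * F y"
  shows "ereal_convex_on S F"
  unfolding ereal_convex_on_def
proof (intro conjI ballI allI impI)
  fix x assume "x \<in> S"
  then have "0 \<le> F x" by (rule assms(2))
  then show "F x \<noteq> -\<infinity>" by auto
next
  fix x y and a b :: real
  assume xy: "x \<in> S" "y \<in> S" and ab: "0 \<le> a" "0 \<le> b" "a + b = 1"
  have nonneg: "0 \<le> F x" "0 \<le> F y" using assms(2) xy by auto
  consider "a = 0" "b = 1" | "b = 0" "a = 1" | "0 < a" "0 < b" using ab by linarith
  then show "F (a *\<^sub>R x + b *\<^sub>R y) \<le> ereal a * F x + ereal b * F y"
  proof cases
    case 3
    then show ?thesis
      using step[OF xy 3 ab(3)] nonneg by (cases "F x"; cases "F y") auto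
  qed (simp_all flip: zero_ereal_def one_ereal_def)
qed (rule assms(1))

lemma ereal_convex_onD:
  assumes "ereal_convex_on S F" "x \<in> S" "y \<in> S" "0 \<le> a" "0 \<le> b" "a + b = 1"
  shows "F (a *\<^sub>R x + b *\<^sub>R y) \<le> ereal a * F x + ereal b * F y"
  using assms unfolding ereal_convex_on_def by blast

text \<open>Multiplication in \<open>ereal\<close> does not distribute over arbitrary sums, since
  infinities of opposite sign may meet. Nonnegativity of both functions makes the regrouping of
  terms valid.\<close>

lemma ereal_convex_on_add_cmult:
  assumes F: "ereal_convex_on S F" and H: "ereal_convex_on S H"
    and nonneg: "\<And>x. x \<in> S \<Longrightarrow> 0 \<le> F x" "\<And>x. x \<in> S \<Longrightarrow> 0 \<le> H x" and "0 \<le> k"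
  shows "ereal_convex_on S (\<lambda>x. F x + ereal k * H x)"
proof (rule ereal_convex_onI)
  show "convex S" using F by (simp add: ereal_convex_on_def)
next
  fix x assume "x \<in> S"
  then show "0 \<le> F x + ereal k * H x" using nonneg \<open>0 \<le> k\<close> by simp
next
  fix x y and a b :: real
  assume xy: "x \<in> S" "y \<in> S" and ab: "0 < a" "0 < b" "a + b = 1"
  let ?z = "a *\<^sub>R x + b *\<^sub>R y"
  have "F ?z + ereal k * H ?z \<le>
      (ereal a * F x + ereal b * F y) + ereal k * (ereal a * H x + ereal b * H y)"
    using xy ab \<open>0 \<le> k\<close>
    by (intro add_mono ereal_mult_left_mono ereal_convex_onD[OF F] ereal_convex_onD[OF H]) auto
  also have "\<dots> = ereal a * (F x + ereal k * H x) + ereal b * (F y + ereal k * H y)"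
    using nonneg xy ab \<open>0 \<le> k\<close>
    by (simp add: ereal_right_distrib mult.left_commute ac_simps)
  finally show "F ?z + ereal k * H ?z \<le> \<dots>" .
qed

text \<open>Partial minimization: combining a candidate at \<open>x\<close> with one at
  \<open>y\<close> gives a candidate at the intermediate point that costs no more than the average.
  An empty \<open>C x\<close> gives the value \<infinity>, so it drops out in the reduction to
  finite values.\<close>

lemma ereal_convex_on_INF:
  fixes g :: "'p \<Rightarrow> real"
  assumes S: "convex S"
    and nonneg: "\<And>x p. \<lbrakk>x \<in> S; p \<in> C x\<rbrakk> \<Longrightarrow> 0 \<le> g p"
    and step: "\<And>x y p q a b. \<lbrakk>x \<in> S; y \<in> S; p \<in> C x; q \<in> C y; 0 \<le> a; 0 \<le> b; a + b = 1\<rbrakk> \<Longrightarrow>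
      \<exists>r \<in> C (a *\<^sub>R x + b *\<^sub>R y). g r \<le> a * g p + b * g q"
  shows "ereal_convex_on S (\<lambda>x. INF p \<in> C x. ereal (g p))"
proof (rule ereal_convex_onI[OF S])
  fix x assume "x \<in> S"
  then show "0 \<le> (INF p \<in> C x. ereal (g p))" by (auto intro!: INF_greatest nonneg)
next
  fix x y and a b :: real
  let ?I = "\<lambda>x. INF p \<in> C x. ereal (g p)"
  assume xy: "x \<in> S" "y \<in> S" and ab: "0 < a" "0 < b" "a + b = 1"
    and fin: "?I x \<noteq> \<infinity>" "?I y \<noteq> \<infinity>"
  have "0 \<le> ?I x" "0 \<le> ?I y" using xy by (auto intro!: INF_greatest nonneg)
  with fin obtain r1 r2 where r: "?I x = ereal r1" "?I y = ereal r2"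
    by (cases "?I x"; cases "?I y") auto
  \<comment> \<open>The infimum need not be attained, so candidates within \<open>e\<close> of it
    are combined. As the weights sum to 1, the total error is again \<open>e\<close>.\<close>
  have "?I (a *\<^sub>R x + b *\<^sub>R y) \<le> ereal (a * r1 + b * r2) + ereal e" if "0 < e" for e
  proof -
    have "?I x < ereal (r1 + e)" "?I y < ereal (r2 + e)" using r that by auto
    then obtain p q where p: "p \<in> C x" "g p < r1 + e" and q: "q \<in> C y" "g q < r2 + e"
      by (auto simp: INF_less_iff)
    obtain r where "r \<in> C (a *\<^sub>R x + b *\<^sub>R y)" and gr: "g r \<le> a * g p + b * g q"
      using step[OF xy p(1) q(1), of a b] ab by auto
    then have "?I (a *\<^sub>R x + b *\<^sub>R y) \<le> ereal (g r)" by (intro INF_lower)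
    also have "g r \<le> a * (r1 + e) + b * (r2 + e)"
      using gr p q ab by (smt (verit) mult_left_mono)
    also have "\<dots> = a * r1 + b * r2 + e"
      using ab(3) by (simp add: algebra_simps flip: distrib_right)
    finally show ?thesis by simp
  qed
  then have "?I (a *\<^sub>R x + b *\<^sub>R y) \<le> ereal (a * r1 + b * r2)"
    by (rule ereal_le_epsilon2[rule_format])
  then show "?I (a *\<^sub>R x + b *\<^sub>R y) \<le> ereal a * ?I x + ereal b * ?I y" using r by simp
qed

text \<open>Each member is bounded by its own average, hence by the average of the suprema. A
  nonempty index set matters because the empty supremum in \<open>ereal\<close> is
  -\<infinity>.\<close>

lemma ereal_convex_on_SUP:
  assumes "convex S" and ne: "I \<noteq> {}"
    and nonneg: "\<And>i x. \<lbrakk>i \<in> I; x \<in> S\<rbrakk> \<Longrightarrow> 0 \<le> F i x"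
    and conv: "\<And>i. i \<in> I \<Longrightarrow> ereal_convex_on S (F i)"
  shows "ereal_convex_on S (\<lambda>x. SUP i \<in> I. F i x)"
proof (rule ereal_convex_onI[OF assms(1)])
  fix x assume "x \<in> S"
  then show "0 \<le> (SUP i \<in> I. F i x)" using ne nonneg by (meson SUP_upper2 ex_in_conv)
next
  fix x y and a b :: real
  assume xy: "x \<in> S" "y \<in> S" and ab: "0 < a" "0 < b" "a + b = 1"
  show "(SUP i \<in> I. F i (a *\<^sub>R x + b *\<^sub>R y)) \<le>
      ereal a * (SUP i \<in> I. F i x) + ereal b * (SUP i \<in> I. F i y)"
  proof (rule SUP_least)
    fix i assume i: "i \<in> I"
    have "F i (a *\<^sub>R x + b *\<^sub>R y) \<le> ereal a * F i x + ereal b * F i y"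
      using ereal_convex_onD[OF conv[OF i] xy] ab by simp
    also have "\<dots> \<le> ereal a * (SUP i \<in> I. F i x) + ereal b * (SUP i \<in> I. F i y)"
      using ab i by (intro add_mono ereal_mult_left_mono SUP_upper) auto
    finally show "F i (a *\<^sub>R x + b *\<^sub>R y) \<le> \<dots>" .
  qed
qed

lemma expansion_flows_convex_combination:
  fixes G :: "('v, 'a) pre_digraph"
  assumes p: "(x1, f1) \<in> expansion_flows G s t u d1" and q: "(x2, f2) \<in> expansion_flows G s t u d2"
    and ab: "0 \<le> a" "0 \<le> b" "a + b = 1"
  shows "(restrict (\<lambda>e. a * x1 e + b * x2 e) (arcs G), restrict (\<lambda>e. a * f1 e + b * f2 e) (arcs G))
    \<in> expansion_flows G s t u (a * d1 + b * d2)"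
proof -
  \<comment> \<open>\<open>restrict\<close> keeps the combination extensional, as membership in
    \<open>expansion_flows\<close> demands.\<close>
  let ?f = "restrict (\<lambda>e. a * f1 e + b * f2 e) (arcs G)"
  \<comment> \<open>Net inflow is linear in the flow, which settles the balance conditions at
    \<open>s\<close>, at \<open>t\<close> and at the inner nodes together.\<close>
  define net where "net f v = (\<Sum>e\<in>in_arcs G v. f e) - (\<Sum>e\<in>out_arcs G v. f e)"
    for f :: "'a \<Rightarrow> real" and v
  have net: "net ?f v = a * net f1 v + b * net f2 v" for v
  proof -
    have "(\<Sum>e\<in>A. ?f e) = a * sum f1 A + b * sum f2 A" if "A \<subseteq> arcs G" for A
    proof -
      have "(\<Sum>e\<in>A. ?f e) = (\<Sum>e\<in>A. a * f1 e + b * f2 e)"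
        using that by (intro sum.cong) auto
      then show ?thesis by (simp add: sum.distrib sum_distrib_left)
    qed
    from this[of "in_arcs G v"] this[of "out_arcs G v"] show ?thesis
      by (auto simp: net_def in_arcs_def out_arcs_def algebra_simps)
  qed
  have cap: "a * f1 e + b * f2 e \<le> u e + (a * x1 e + b * x2 e)" if "e \<in> arcs G" for e
  proof -
    have "f1 e \<le> u e + x1 e" "f2 e \<le> u e + x2 e"
      using p q that by (auto simp: expansion_flows_def)
    then have "a * f1 e + b * f2 e \<le> a * (u e + x1 e) + b * (u e + x2 e)"
      using ab by (intro add_mono mult_left_mono) auto
    \<comment> \<open>The capacity \<open>u e\<close> is the same for both flows, so its two shares
      add up to exactly \<open>u e\<close>.\<close>
    also have "\<dots> = (a + b) * u e + (a * x1 e + b * x2 e)" by (simp add: algebra_simps)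
    finally show ?thesis using ab(3) by simp
  qed
  show ?thesis
    using p q ab cap net
    unfolding expansion_flows_def net_def[symmetric] by auto
qed

lemma ereal_convex_on_expansion_cost:
  fixes G :: "('v, 'a) pre_digraph"
  assumes c: "\<And>e. e \<in> arcs G \<Longrightarrow> 0 \<le> c e" and S: "convex S"
  shows "ereal_convex_on S
    (\<lambda>d. INF (x, f) \<in> expansion_flows G s t u d. ereal (\<Sum>e\<in>arcs G. c e * x e))"
proof -
  define g where "g = (\<lambda>(x :: 'a \<Rightarrow> real, f :: 'a \<Rightarrow> real). \<Sum>e\<in>arcs G. c e * x e)"
  have "ereal_convex_on S (\<lambda>d. INF p \<in> expansion_flows G s t u d. ereal (g p))"
  proof (rule ereal_convex_on_INF[OF S])
    fix d p assume "p \<in> expansion_flows G s t u d"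
    then show "0 \<le> g p" using c by (auto simp: g_def expansion_flows_def intro!: sum_nonneg)
  next
    fix d1 d2 p q and a b :: real
    assume pq: "p \<in> expansion_flows G s t u d1" "q \<in> expansion_flows G s t u d2"
      and ab: "0 \<le> a" "0 \<le> b" "a + b = 1"
    obtain x1 f1 x2 f2 where [simp]: "p = (x1, f1)" "q = (x2, f2)" by (cases p; cases q)
    let ?r = "(restrict (\<lambda>e. a * x1 e + b * x2 e) (arcs G),
      restrict (\<lambda>e. a * f1 e + b * f2 e) (arcs G))"
    have "g ?r = a * g p + b * g q"
      by (simp add: g_def distrib_left sum.distrib sum_distrib_left mult.left_commute)
    moreover have "?r \<in> expansion_flows G s t u (a *\<^sub>R d1 + b *\<^sub>R d2)"
      using expansion_flows_convex_combination pq ab by simp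
    ultimately show "\<exists>r \<in> expansion_flows G s t u (a *\<^sub>R d1 + b *\<^sub>R d2). g r \<le> a * g p + b * g q"
      by (metis order_refl)
  qed
  then show ?thesis by (simp add: g_def case_prod_unfold)
qed

lemma demand_distributions_nonempty:
  assumes "0 < \<mu>"
  shows "demand_distributions \<mu> \<sigma> \<noteq> {}"
proof -
  \<comment> \<open>\<open>w\<close> is the second moment that mean and variance prescribe. Mass
    \<open>p\<close> at a point \<open>h\<close> and the rest at 0 must satisfy
    \<open>h * p = \<mu>\<close> and \<open>h\<^sup>2 * p = w\<close>, which forces
    \<open>h = w / \<mu>\<close> and \<open>p = \<mu>\<^sup>2 / w\<close>. For
    \<open>\<sigma> = 0\<close> this is the point mass at \<open>\<mu>\<close>.\<close>
  define w where "w = \<mu>\<^sup>2 + \<sigma>\<^sup>2"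
  define p where "p = \<mu>\<^sup>2 / w"
  define X where "X = (\<lambda>b. if b then w / \<mu> else 0)"
  have w: "0 < w" unfolding w_def using assms by (intro add_pos_nonneg) auto
  have "\<mu>\<^sup>2 \<le> w" by (simp add: w_def)
  then have p: "0 \<le> p" "p \<le> 1" using w unfolding p_def by simp_all
  let ?M = "measure_pmf (bernoulli_pmf p)"
  have X: "X \<in> ?M \<rightarrow>\<^sub>M borel" by simp
  have int: "integrable ?M h" for h :: "bool \<Rightarrow> real"
    by (rule integrable_measure_pmf_finite) simp
  have mean: "w / \<mu> * p = \<mu>"
    using assms w by (simp add: p_def power2_eq_square)
  have var: "(w / \<mu> - \<mu>)\<^sup>2 * p + \<mu>\<^sup>2 * (1 - p) = \<sigma>\<^sup>2"
  proof -
    have "(w / \<mu> - \<mu>)\<^sup>2 * p + \<mu>\<^sup>2 * (1 - p) = w / \<mu> * (w / \<mu> * p) - 2 * \<mu> * (w / \<mu> * p) + \<mu>\<^sup>2"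
      by (simp add: power2_eq_square algebra_simps)
    also have "\<dots> = w - \<mu>\<^sup>2"
      unfolding mean using assms by (simp add: power2_eq_square)
    finally show ?thesis by (simp add: w_def)
  qed
  have "distr ?M borel X \<in> demand_distributions \<mu> \<sigma>"
    unfolding demand_distributions_def
    using X int p assms w mean var
    by (auto simp: integral_distr integrable_distr_eq AE_distr_iff X_def
        intro!: prob_space.real_distribution_distr prob_space_measure_pmf)
  then show ?thesis by blast
qed

text \<open>Constants are integrable under a probability measure, so integrability passes from
  \<open>d\<close> to the excess. Monotonicity and linearity of the Bochner integral rely on it
  below.\<close>

lemma integrable_excess_demand:
  assumes "P \<in> demand_distributions \<mu> \<sigma>"
  shows "integrable P (\<lambda>d. max (d - r) 0)"
proof -
  interpret real_distribution P using assms by (simp add: demand_distributions_def)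
  show ?thesis using assms by (auto simp: demand_distributions_def)
qed

lemma ereal_convex_on_expected_excess:
  assumes P: "P \<in> demand_distributions \<mu> \<sigma>" and S: "convex S"
  shows "ereal_convex_on S (\<lambda>r. ereal (\<integral>d. max (d - r) 0 \<partial>P))"
proof (rule ereal_convex_onI[OF S])
  fix r show "0 \<le> ereal (\<integral>d. max (d - r) 0 \<partial>P)" by simp
next
  fix x y a b :: real
  assume ab: "0 < a" "0 < b" "a + b = 1"
  note int = integrable_excess_demand[OF P]
  have "(\<integral>d. max (d - (a * x + b * y)) 0 \<partial>P) \<le>
      (\<integral>d. a * max (d - x) 0 + b * max (d - y) 0 \<partial>P)"
  proof (rule integral_mono)
    fix d
    \<comment> \<open>Splitting \<open>d\<close> by the weights turns the shortfall into an average
      of the two shortfalls. The resulting bound is itself nonnegative, so it also bounds the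
      maximum with 0.\<close>
    have "d - (a * x + b * y) = (a + b) * d - (a * x + b * y)" using ab(3) by simp
    also have "\<dots> = a * (d - x) + b * (d - y)" by (simp add: algebra_simps)
    also have "\<dots> \<le> a * max (d - x) 0 + b * max (d - y) 0"
      using ab by (intro add_mono mult_left_mono) auto
    finally show "max (d - (a * x + b * y)) 0 \<le> a * max (d - x) 0 + b * max (d - y) 0"
      using ab by simp
  qed (use int in auto)
  also have "\<dots> = a * (\<integral>d. max (d - x) 0 \<partial>P) + b * (\<integral>d. max (d - y) 0 \<partial>P)"
    using int by simp
  finally show "ereal (\<integral>d. max (d - (a *\<^sub>R x + b *\<^sub>R y)) 0 \<partial>P) \<le>
      ereal a * ereal (\<integral>d. max (d - x) 0 \<partial>P) + ereal b * ereal (\<integral>d. max (d - y) 0 \<partial>P)"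
    by simp
qed

lemma worst_unsatisfied_demand_nonneg:
  assumes "0 < \<mu>"
  shows "0 \<le> worst_unsatisfied_demand \<mu> \<sigma> r"
proof -
  obtain P where "P \<in> demand_distributions \<mu> \<sigma>"
    using demand_distributions_nonempty[OF assms] by blast
  then show ?thesis
    unfolding worst_unsatisfied_demand_def by (rule SUP_upper2) simp
qed

lemma ereal_convex_on_worst_unsatisfied_demand:
  assumes "0 < \<mu>" and "convex S"
  shows "ereal_convex_on S (worst_unsatisfied_demand \<mu> \<sigma>)"
  unfolding worst_unsatisfied_demand_def
  using assms demand_distributions_nonempty
  by (intro ereal_convex_on_SUP ereal_convex_on_expected_excess) auto

theorem theorem1:
  fixes G :: "('v, 'a) pre_digraph" and s t :: 'v
    and u c :: "'a \<Rightarrow> real" and \<phi> \<mu> \<sigma> :: real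
  assumes "fin_digraph G"
    and "s \<in> verts G" and "t \<in> verts G" and "s \<noteq> t"
    and "\<And>a. a \<in> arcs G \<Longrightarrow> 0 \<le> u a"
    and "\<And>a. a \<in> arcs G \<Longrightarrow> 0 \<le> c a"
    and "0 \<le> \<phi>" and "0 < \<mu>" and "0 \<le> \<sigma>"
  shows "ereal_convex_on {0..} (expansion_objective G s t u c \<phi> \<mu> \<sigma>)"
proof -
  \<comment> \<open>Nonnegative costs give the sign condition on the first summand, also when no
    feasible pair exists and the infimum is \<infinity>.\<close>
  have "0 \<le> (INF (x, f) \<in> expansion_flows G s t u d. ereal (\<Sum>a\<in>arcs G. c a * x a))" for d
    using assms(6) by (auto simp: expansion_flows_def intro!: INF_greatest sum_nonneg)
  then show ?thesis
    unfolding expansion_objective_def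
    using assms worst_unsatisfied_demand_nonneg
    by (intro ereal_convex_on_add_cmult ereal_convex_on_expansion_cost
        ereal_convex_on_worst_unsatisfied_demand) auto
qed

end
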